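(* Let $\varphi$ be a disjunction of weakly rational word formulae and let $\psi$ be a positive boolean combination of ena formulae, each associated to a word that is a product $u_1\cdots u_r$ of outer commutator words $u_1,\dots,u_r$ with pairwise disjoint supports, and to any letter. Then $\varphi\lor\psi$ and $\varphi\land\psi$ are concise in the class of residually finite groups.
   Context: A formula means a first-order formula with exactly one free variable $y$ in the language of groups, without parameters. For a formula $\varphi$ and a group $G$, put $G_\varphi=\{g\in G\mid \varphi(g)\text{ is true in }G\}$ and $\varphi(G)=\langle G_\varphi\rangle$. A formula $\varphi$ is concise in a class $\mathcal C$ of groups if for all $G\in\mathcal C$, $|G_\varphi|<\infty$ implies $|\varphi(G)|<\infty$. A word is an element of the free group on a countable set of letters; its support is the set of letters occurring in it; words are disjoint if their supports are. The word formula associated to a word $w(x_1,\dots,x_n)$ is $\exists x_1,\dots,x_n\colon w(x_1,\dots,x_n)=y$, which defines in $G$ the set of $w$-values. A formula $\varphi$ is weakly rational if for every finite group $G$, every $g\in G_\varphi$ and every $m\in\mathbb N$ coprime to $|G|$, one has $g^m\in G_\varphi$. The ena ("existential negative atomic") formula associated to a word $w$ and a letter $y$ is $\exists x_1,\dots,x_n\colon w(x_1,\dots,x_n,y)\neq 1$, where $x_1,\dots,x_n$ are the letters of $w$ other than $y$; the letter $y$ plays the role of the free variable (and the free variables of several formulae in a boolean combination are identified). The set of outer commutator words is the smallest set of words containing all letters and closed under $(v,w)\mapsto[v,w]$ for disjoint outer commutator words $v,w$, where $[v,w]=v^{-1}w^{-1}vw$. A positive boolean combination is a (finite) boolean combination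 using only $\land$ and $\lor$, without negation. *)

theory Defs
  imports "HOL-Algebra.Algebra"
begin

section \<open>Words\<close>

text \<open>
  The letters are the natural numbers. An element of the free group on them is a reduced list of
  signed letters: \<open>(n, True)\<close> stands for the letter \<open>n\<close> and \<open>(n, False)\<close> for its inverse.
\<close>

definition flip :: "nat \<times> bool \<Rightarrow> nat \<times> bool" where
  "flip a = (fst a, \<not> snd a)"

definition reduced :: "(nat \<times> bool) list \<Rightarrow> bool" where
  "reduced w \<longleftrightarrow> (\<forall>i. Suc i < length w \<longrightarrow> w ! Suc i \<noteq> flip (w ! i))"

fun cancel_cons :: "nat \<times> bool \<Rightarrow> (nat \<times> bool) list \<Rightarrow> (nat \<times> bool) list" where
  "cancel_cons a [] = [a]"
| "cancel_cons a (b # w) = (if b = flip a then w else a # b # w)"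

definition free_group :: "(nat \<times> bool) list monoid" where
  "free_group = \<lparr>carrier = {w. reduced w}, monoid.mult = (\<lambda>v w. foldr cancel_cons v w), one = []\<rparr>"

definition support :: "(nat \<times> bool) list \<Rightarrow> nat set" where
  "support w = fst ` set w"

definition disjoint_words :: "(nat \<times> bool) list \<Rightarrow> (nat \<times> bool) list \<Rightarrow> bool" where
  "disjoint_words v w \<longleftrightarrow> support v \<inter> support w = {}"

definition commutator_word ::
  "(nat \<times> bool) list \<Rightarrow> (nat \<times> bool) list \<Rightarrow> (nat \<times> bool) list" where
  "commutator_word v w =
     inv\<^bsub>free_group\<^esub> v \<otimes>\<^bsub>free_group\<^esub> inv\<^bsub>free_group\<^esub> w \<otimes>\<^bsub>free_group\<^esub> v \<otimes>\<^bsub>free_group\<^esub> w"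

inductive outer_commutator :: "(nat \<times> bool) list \<Rightarrow> bool" where
  letter: "outer_commutator [(n, True)]"
| commutator: "\<lbrakk>outer_commutator v; outer_commutator w; disjoint_words v w\<rbrakk>
    \<Longrightarrow> outer_commutator (commutator_word v w)"

definition word_product :: "(nat \<times> bool) list list \<Rightarrow> (nat \<times> bool) list" where
  "word_product us = foldr (\<lambda>u v. u \<otimes>\<^bsub>free_group\<^esub> v) us \<one>\<^bsub>free_group\<^esub>"

lemma flip_flip [simp]: "flip (flip a) = a"
  by (simp add: flip_def)

lemma flip_neq [simp]: "flip a \<noteq> a" "a \<noteq> flip a"
  by (auto simp: flip_def prod_eq_iff)

lemma reduced_Nil [simp]: "reduced []"
  by (simp add: reduced_def)

lemma reduced_Cons: "reduced (a # w) \<longleftrightarrow> reduced w \<and> (w = [] \<or> hd w \<noteq> flip a)"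
proof (cases w)
  case (Cons b v)
  then show ?thesis
    by (auto simp: reduced_def nth_Cons split: nat.splits)
qed (simp add: reduced_def)

lemma reduced_cancel_cons: "reduced w \<Longrightarrow> reduced (cancel_cons a w)"
  by (cases w) (auto simp: reduced_Cons)

lemma reduced_foldr: "reduced w \<Longrightarrow> reduced (foldr cancel_cons v w)"
  by (induction v) (auto intro: reduced_cancel_cons)

lemma cancel_cons_flip: "reduced w \<Longrightarrow> cancel_cons a (cancel_cons (flip a) w) = w"
  by (cases w; cases "tl w") (auto simp: reduced_Cons)

lemma foldr_cancel_cons:
  assumes "reduced w"
  shows "foldr cancel_cons (cancel_cons a v) w = cancel_cons a (foldr cancel_cons v w)"
proof (cases v)
  case (Cons b u)
  then show ?thesis
    using cancel_cons_flip[OF reduced_foldr[OF assms], of a u] by auto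
qed simp

lemma foldr_foldr_cancel_cons:
  assumes "reduced w"
  shows "foldr cancel_cons (foldr cancel_cons u v) w =
         foldr cancel_cons u (foldr cancel_cons v w)"
  by (induction u) (auto simp: foldr_cancel_cons[OF assms])

lemma foldr_cancel_cons_Nil: "reduced w \<Longrightarrow> foldr cancel_cons w [] = w"
proof (induction w)
  case (Cons a w)
  then show ?case by (cases w) (auto simp: reduced_Cons)
qed simp

lemma foldr_inverse: "reduced w \<Longrightarrow> foldr cancel_cons (rev (map flip v)) (foldr cancel_cons v w) = w"
proof (induction v)
  case (Cons a v)
  then show ?case
    using cancel_cons_flip[OF reduced_foldr[OF Cons.prems], of "flip a" v] by simp
qed simp

theorem group_free_group: "group free_group"
proof (rule groupI)
  fix w assume w: "w \<in> carrier free_group"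
  let ?v = "foldr cancel_cons (rev (map flip w)) []"
  have "foldr cancel_cons ?v w = foldr cancel_cons (rev (map flip w)) (foldr cancel_cons w [])"
    using w by (simp add: free_group_def foldr_foldr_cancel_cons foldr_cancel_cons_Nil)
  also have "\<dots> = []" by (simp add: foldr_inverse)
  finally show "\<exists>v\<in>carrier free_group. v \<otimes>\<^bsub>free_group\<^esub> w = \<one>\<^bsub>free_group\<^esub>"
    using reduced_foldr[of "[]"] by (intro bexI[of _ ?v]) (auto simp: free_group_def)
qed (auto simp: free_group_def reduced_foldr foldr_foldr_cancel_cons)

section \<open>First-order formulae in the language of groups\<close>

text \<open>
  The distinguished free variable of a formula is \<open>FreeVar\<close>; the variables \<open>LetterVar n\<close>
  correspond to the letters of words. Keeping the two kinds apart identifies the free variables of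
  all formulae, whichever letter they come from.
\<close>

datatype var = FreeVar | LetterVar nat

datatype gterm = VarT var | OneT | InvT gterm | MulT gterm gterm

datatype formula =
    Eq gterm gterm
  | Neg formula
  | Conj formula formula
  | Disj formula formula
  | Exists var formula
  | All var formula

primrec gterm_eval :: "('a, 'b) monoid_scheme \<Rightarrow> (var \<Rightarrow> 'a) \<Rightarrow> gterm \<Rightarrow> 'a" where
  "gterm_eval G e (VarT x) = e x"
| "gterm_eval G e OneT = \<one>\<^bsub>G\<^esub>"
| "gterm_eval G e (InvT t) = inv\<^bsub>G\<^esub> (gterm_eval G e t)"
| "gterm_eval G e (MulT s t) = gterm_eval G e s \<otimes>\<^bsub>G\<^esub> gterm_eval G e t"

primrec sat :: "('a, 'b) monoid_scheme \<Rightarrow> (var \<Rightarrow> 'a) \<Rightarrow> formula \<Rightarrow> bool" where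
  "sat G e (Eq s t) \<longleftrightarrow> gterm_eval G e s = gterm_eval G e t"
| "sat G e (Neg \<phi>) \<longleftrightarrow> \<not> sat G e \<phi>"
| "sat G e (Conj \<phi> \<psi>) \<longleftrightarrow> sat G e \<phi> \<and> sat G e \<psi>"
| "sat G e (Disj \<phi> \<psi>) \<longleftrightarrow> sat G e \<phi> \<or> sat G e \<psi>"
| "sat G e (Exists x \<phi>) \<longleftrightarrow> (\<exists>a\<in>carrier G. sat G (e(x := a)) \<phi>)"
| "sat G e (All x \<phi>) \<longleftrightarrow> (\<forall>a\<in>carrier G. sat G (e(x := a)) \<phi>)"

primrec gterm_vars :: "gterm \<Rightarrow> var set" where
  "gterm_vars (VarT x) = {x}"
| "gterm_vars OneT = {}"
| "gterm_vars (InvT t) = gterm_vars t"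
| "gterm_vars (MulT s t) = gterm_vars s \<union> gterm_vars t"

primrec free_vars :: "formula \<Rightarrow> var set" where
  "free_vars (Eq s t) = gterm_vars s \<union> gterm_vars t"
| "free_vars (Neg \<phi>) = free_vars \<phi>"
| "free_vars (Conj \<phi> \<psi>) = free_vars \<phi> \<union> free_vars \<psi>"
| "free_vars (Disj \<phi> \<psi>) = free_vars \<phi> \<union> free_vars \<psi>"
| "free_vars (Exists x \<phi>) = free_vars \<phi> - {x}"
| "free_vars (All x \<phi>) = free_vars \<phi> - {x}"

text \<open>
  For a formula whose only free variable is \<open>FreeVar\<close>, the value \<open>\<one>\<close> given to the other
  variables is irrelevant, see \<open>sat_cong\<close> below.
\<close>

definition definable_set :: "('a, 'b) monoid_scheme \<Rightarrow> formula \<Rightarrow> 'a set" where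
  "definable_set G \<phi> = {g \<in> carrier G. sat G ((\<lambda>_. \<one>\<^bsub>G\<^esub>)(FreeVar := g)) \<phi>}"

definition verbal_subgroup :: "('a, 'b) monoid_scheme \<Rightarrow> formula \<Rightarrow> 'a set" where
  "verbal_subgroup G \<phi> = generate G (definable_set G \<phi>)"

definition concise :: "formula \<Rightarrow> 'a monoid set \<Rightarrow> bool" where
  "concise \<phi> \<C> \<longleftrightarrow>
     (\<forall>G\<in>\<C>. finite (definable_set G \<phi>) \<longrightarrow> finite (verbal_subgroup G \<phi>))"

text \<open>
  Every finite group is isomorphic to one whose elements are natural numbers, so quantifying over
  the latter is enough; \<open>weakly_rationalD\<close> below confirms this.
\<close>

definition weakly_rational :: "formula \<Rightarrow> bool" where
  "weakly_rational \<phi> \<longleftrightarrow>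
     (\<forall>G :: nat monoid. group G \<and> finite (carrier G) \<longrightarrow>
        (\<forall>g\<in>definable_set G \<phi>. \<forall>m::nat. coprime m (order G) \<longrightarrow> g [^]\<^bsub>G\<^esub> m \<in> definable_set G \<phi>))"

definition residually_finite :: "('a, 'b) monoid_scheme \<Rightarrow> bool" where
  "residually_finite G \<longleftrightarrow> group G \<and>
     (\<forall>g\<in>carrier G. g \<noteq> \<one>\<^bsub>G\<^esub> \<longrightarrow> (\<exists>N. N \<lhd> G \<and> finite (rcosets\<^bsub>G\<^esub> N) \<and> g \<notin> N))"

section \<open>Formulae associated to words\<close>

text \<open>The argument \<open>\<sigma>\<close> says which variable each letter becomes.\<close>

fun word_gterm :: "(nat \<Rightarrow> var) \<Rightarrow> (nat \<times> bool) list \<Rightarrow> gterm" where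
  "word_gterm \<sigma> [] = OneT"
| "word_gterm \<sigma> ((n, b) # w) =
     MulT (if b then VarT (\<sigma> n) else InvT (VarT (\<sigma> n))) (word_gterm \<sigma> w)"

definition exists_letters :: "nat set \<Rightarrow> formula \<Rightarrow> formula" where
  "exists_letters A \<phi> = foldr (\<lambda>n. Exists (LetterVar n)) (sorted_list_of_set A) \<phi>"

definition word_formula :: "(nat \<times> bool) list \<Rightarrow> formula" where
  "word_formula w = exists_letters (support w) (Eq (word_gterm LetterVar w) (VarT FreeVar))"

definition ena_formula :: "(nat \<times> bool) list \<Rightarrow> nat \<Rightarrow> formula" where
  "ena_formula w y =
     exists_letters (support w - {y}) (Neg (Eq (word_gterm (LetterVar(y := FreeVar)) w) OneT))"

inductive disjunction_of :: "(formula \<Rightarrow> bool) \<Rightarrow> formula \<Rightarrow> bool" for P where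
  base: "P \<phi> \<Longrightarrow> disjunction_of P \<phi>"
| disj: "\<lbrakk>disjunction_of P \<phi>; disjunction_of P \<psi>\<rbrakk> \<Longrightarrow> disjunction_of P (Disj \<phi> \<psi>)"

inductive positive_combination_of :: "(formula \<Rightarrow> bool) \<Rightarrow> formula \<Rightarrow> bool" for P where
  base: "P \<phi> \<Longrightarrow> positive_combination_of P \<phi>"
| conj: "\<lbrakk>positive_combination_of P \<phi>; positive_combination_of P \<psi>\<rbrakk>
    \<Longrightarrow> positive_combination_of P (Conj \<phi> \<psi>)"
| disj: "\<lbrakk>positive_combination_of P \<phi>; positive_combination_of P \<psi>\<rbrakk>
    \<Longrightarrow> positive_combination_of P (Disj \<phi> \<psi>)"

definition weakly_rational_word_formula :: "formula \<Rightarrow> bool" where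
  "weakly_rational_word_formula \<phi> \<longleftrightarrow>
     weakly_rational \<phi> \<and> (\<exists>w\<in>carrier free_group. \<phi> = word_formula w)"

text \<open>The letter \<open>y\<close> need not occur in the word.\<close>

definition ena_outer_product_formula :: "formula \<Rightarrow> bool" where
  "ena_outer_product_formula \<psi> \<longleftrightarrow>
     (\<exists>us y. us \<noteq> [] \<and> (\<forall>u\<in>set us. outer_commutator u) \<and> sorted_wrt disjoint_words us \<and>
        \<psi> = ena_formula (word_product us) y)"

section \<open>Properties of satisfaction\<close>

lemma gterm_eval_cong:
  "(\<And>x. x \<in> gterm_vars t \<Longrightarrow> e x = e' x) \<Longrightarrow> gterm_eval G e t = gterm_eval G e' t"
  by (induction t) auto

lemma sat_cong:
  "(\<And>x. x \<in> free_vars \<phi> \<Longrightarrow> e x = e' x) \<Longrightarrow> sat G e \<phi> \<longleftrightarrow> sat G e' \<phi>"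
proof (induction \<phi> arbitrary: e e')
  case (Eq s t)
  then show ?case
    using gterm_eval_cong[of s e e' G] gterm_eval_cong[of t e e' G] by simp
next
  case (Exists x \<phi>)
  have "sat G (e(x := a)) \<phi> \<longleftrightarrow> sat G (e'(x := a)) \<phi>" for a
    by (rule Exists.IH) (use Exists.prems in auto)
  then show ?case by simp
next
  case (All x \<phi>)
  have "sat G (e(x := a)) \<phi> \<longleftrightarrow> sat G (e'(x := a)) \<phi>" for a
    by (rule All.IH) (use All.prems in auto)
  then show ?case by simp
next
  case (Neg \<phi>)
  from Neg.IH[of e e'] Neg.prems show ?case by simp
next
  case (Conj \<phi> \<psi>)
  from Conj.IH[of e e'] Conj.prems show ?case by simp
next
  case (Disj \<phi> \<psi>)
  from Disj.IH[of e e'] Disj.prems show ?case by simp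
qed

lemma gterm_vars_word_gterm: "gterm_vars (word_gterm \<sigma> w) = \<sigma> ` support w"
  by (induction \<sigma> w rule: word_gterm.induct) (auto simp: support_def)

lemma free_vars_exists_letters:
  assumes "finite A"
  shows "free_vars (exists_letters A \<phi>) = free_vars \<phi> - LetterVar ` A"
proof -
  have "free_vars (foldr (\<lambda>n. Exists (LetterVar n)) ns \<phi>) = free_vars \<phi> - LetterVar ` set ns" for ns
    by (induction ns) auto
  then show ?thesis using assms by (simp add: exists_letters_def)
qed

lemma finite_support [simp]: "finite (support w)"
  by (simp add: support_def)

lemma free_vars_word_formula: "free_vars (word_formula w) = {FreeVar}"
  by (auto simp: word_formula_def free_vars_exists_letters gterm_vars_word_gterm)

lemma free_vars_ena_formula:
  "free_vars (ena_formula w y) = (if y \<in> support w then {FreeVar} else {})"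
  by (auto simp: ena_formula_def free_vars_exists_letters gterm_vars_word_gterm)

lemma sat_exists_letters:
  fixes G :: "('a, 'b) monoid_scheme"
  assumes "finite A"
  shows "sat G e (exists_letters A \<phi>) \<longleftrightarrow>
    (\<exists>f. (\<forall>n\<in>A. f n \<in> carrier G) \<and>
         sat G (\<lambda>x. case x of FreeVar \<Rightarrow> e FreeVar
                     | LetterVar n \<Rightarrow> (if n \<in> A then f n else e (LetterVar n))) \<phi>)"
proof -
  have "sat G e (foldr (\<lambda>n. Exists (LetterVar n)) ns \<phi>) \<longleftrightarrow>
    (\<exists>f. (\<forall>n\<in>set ns. f n \<in> carrier G) \<and>
         sat G (\<lambda>x. case x of FreeVar \<Rightarrow> e FreeVar
                     | LetterVar n \<Rightarrow> (if n \<in> set ns then f n else e (LetterVar n))) \<phi>)"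
    if "distinct ns" for ns
    using that
  proof (induction ns arbitrary: e)
    case Nil
    have "(\<lambda>x. case x of FreeVar \<Rightarrow> e FreeVar
             | LetterVar n \<Rightarrow> (if n \<in> set [] then f n else e (LetterVar n))) = e" for f
      by (auto split: var.split simp: fun_eq_iff)
    then show ?case by simp
  next
    case (Cons k ns)
    let ?E = "\<lambda>e ns f x. case x of FreeVar \<Rightarrow> e FreeVar
                 | LetterVar n \<Rightarrow> (if n \<in> set ns then f n else (e (LetterVar n) :: 'a))"
    have eq: "?E (e(LetterVar k := a)) ns f = ?E e (k # ns) (f(k := a))" for a f
      using Cons.prems by (auto split: var.split simp: fun_eq_iff)
    have "sat G e (foldr (\<lambda>n. Exists (LetterVar n)) (k # ns) \<phi>) \<longleftrightarrow>
      (\<exists>a\<in>carrier G. \<exists>f. (\<forall>n\<in>set ns. f n \<in> carrier G) \<and>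
         sat G (?E (e(LetterVar k := a)) ns f) \<phi>)"
      using Cons.prems by (simp only: foldr.simps comp_apply sat.simps Cons.IH distinct.simps)
    also have "\<dots> \<longleftrightarrow> (\<exists>f. (\<forall>n\<in>set (k # ns). f n \<in> carrier G) \<and> sat G (?E e (k # ns) f) \<phi>)"
      (is "?L \<longleftrightarrow> ?R")
    proof
      assume ?L
      then obtain a f where "a \<in> carrier G" "\<forall>n\<in>set ns. f n \<in> carrier G"
        "sat G (?E (e(LetterVar k := a)) ns f) \<phi>" by blast
      then show ?R unfolding eq by (intro exI[of _ "f(k := a)"]) auto
    next
      assume ?R
      then obtain f where f: "\<forall>n\<in>set (k # ns). f n \<in> carrier G"
        "sat G (?E e (k # ns) f) \<phi>" by blast
      then have "sat G (?E (e(LetterVar k := f k)) ns f) \<phi>"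
        unfolding eq fun_upd_triv by simp
      with f show ?L by auto
    qed
    finally show ?case .
  qed
  from this[OF distinct_sorted_list_of_set, of A, unfolded set_sorted_list_of_set[OF assms]]
  show ?thesis unfolding exists_letters_def .
qed

lemma gterm_eval_closed:
  "\<lbrakk>group G; range e \<subseteq> carrier G\<rbrakk> \<Longrightarrow> gterm_eval G e t \<in> carrier G"
  by (induction t) (auto intro: group.inv_closed simp: group.is_monoid monoid.m_closed)

lemma gterm_eval_hom:
  assumes "group_hom G H h" "range e \<subseteq> carrier G"
  shows "gterm_eval H (h \<circ> e) t = h (gterm_eval G e t)"
proof -
  interpret group_hom G H h by fact
  have "gterm_eval G e t \<in> carrier G" for t
    using assms(2) by (rule gterm_eval_closed[OF G.is_group])
  then show ?thesis by (induction t) simp_all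
qed

lemma sat_iso:
  assumes "group G" "group H" "h \<in> iso G H" "range e \<subseteq> carrier G"
  shows "sat H (h \<circ> e) \<phi> \<longleftrightarrow> sat G e \<phi>"
proof -
  have hom: "group_hom G H h"
    using assms by (simp add: group_hom_def group_hom_axioms_def iso_def)
  have bij: "bij_betw h (carrier G) (carrier H)" using assms(3) by (simp add: iso_def)
  have carrier_H: "carrier H = h ` carrier G" using bij by (simp add: bij_betw_def)
  show ?thesis using assms(4)
  proof (induction \<phi> arbitrary: e)
    case (Eq s t)
    have "gterm_eval G e u \<in> carrier G" for u
      using gterm_eval_closed[OF assms(1) Eq] .
    then have "h (gterm_eval G e s) = h (gterm_eval G e t) \<longleftrightarrow> gterm_eval G e s = gterm_eval G e t"
      using bij by (intro inj_on_eq_iff) (auto simp: bij_betw_def)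
    then show ?case
      by (simp only: sat.simps gterm_eval_hom[OF hom Eq])
  next
    case (Exists x \<phi>)
    have "sat H ((h \<circ> e)(x := h a)) \<phi> \<longleftrightarrow> sat G (e(x := a)) \<phi>" if "a \<in> carrier G" for a
    proof -
      have "range (e(x := a)) \<subseteq> carrier G" using Exists.prems that by auto
      from Exists.IH[OF this] show ?thesis by (simp only: fun_upd_comp)
    qed
    then show ?case
      by (simp only: sat.simps carrier_H bex_simps ball_simps cong: bex_cong ball_cong)
  next
    case (All x \<phi>)
    have "sat H ((h \<circ> e)(x := h a)) \<phi> \<longleftrightarrow> sat G (e(x := a)) \<phi>" if "a \<in> carrier G" for a
    proof -
      have "range (e(x := a)) \<subseteq> carrier G" using All.prems that by auto
      from All.IH[OF this] show ?thesis by (simp only: fun_upd_comp)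
    qed
    then show ?case
      by (simp only: sat.simps carrier_H bex_simps ball_simps cong: bex_cong ball_cong)
  qed auto
qed

lemma definable_set_iso:
  assumes "group G" "group H" "h \<in> iso G H"
  shows "definable_set H \<phi> = h ` definable_set G \<phi>"
proof -
  have carrier_H: "carrier H = h ` carrier G" using assms(3) by (simp add: iso_def bij_betw_def)
  have one: "h \<one>\<^bsub>G\<^esub> = \<one>\<^bsub>H\<^esub>"
    using assms by (intro hom_one) (auto simp: iso_def)
  have "sat H ((\<lambda>_. \<one>\<^bsub>H\<^esub>)(FreeVar := h g)) \<phi> \<longleftrightarrow> sat G ((\<lambda>_. \<one>\<^bsub>G\<^esub>)(FreeVar := g)) \<phi>"
    if "g \<in> carrier G" for g
  proof -
    have "h \<circ> ((\<lambda>_. \<one>\<^bsub>G\<^esub>)(FreeVar := g)) = (\<lambda>_. \<one>\<^bsub>H\<^esub>)(FreeVar := h g)"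
      using one by (auto simp: fun_eq_iff)
    moreover have "range ((\<lambda>_. \<one>\<^bsub>G\<^esub>)(FreeVar := g)) \<subseteq> carrier G"
      using that assms(1) by (auto simp: group.is_monoid)
    ultimately show ?thesis using sat_iso[OF assms] by metis
  qed
  then show ?thesis by (auto simp: definable_set_def carrier_H)
qed

lemma weakly_rationalD:
  fixes G :: "'a monoid"
  assumes "weakly_rational \<phi>" "group G" "finite (carrier G)"
    and "g \<in> definable_set G \<phi>" "coprime m (order G)"
  shows "g [^]\<^bsub>G\<^esub> m \<in> definable_set G \<phi>"
proof -
  interpret group G by fact
  obtain f :: "'a \<Rightarrow> nat" where f: "inj_on f (carrier G)"
    using assms(3) finite_imp_inj_to_nat_seg by blast
  define k where "k = inv_into (carrier G) f"
  define H where "H = \<lparr>carrier = f ` carrier G, monoid.mult = (\<lambda>a b. f (k a \<otimes>\<^bsub>G\<^esub> k b)), one = f \<one>\<^bsub>G\<^esub>\<rparr>"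
  have k: "k (f x) = x" if "x \<in> carrier G" for x
    using f that by (simp add: k_def)
  have H: "group H"
  proof (rule groupI)
    fix x assume "x \<in> carrier H"
    then obtain a where "a \<in> carrier G" "x = f a" by (auto simp: H_def)
    then show "\<exists>y\<in>carrier H. y \<otimes>\<^bsub>H\<^esub> x = \<one>\<^bsub>H\<^esub>"
      by (intro bexI[of _ "f (inv\<^bsub>G\<^esub> a)"]) (auto simp: H_def k)
  qed (auto simp: H_def k m_assoc)
  have iso: "f \<in> iso G H"
    using f by (auto simp: iso_def hom_def H_def k bij_betw_def)
  have "finite (carrier H)" "order H = order G"
    using assms(3) f by (auto simp: H_def order_def card_image)
  moreover have "f g \<in> definable_set H \<phi>"
    using definable_set_iso[OF is_group H iso] assms(4) by simp
  ultimately have "f g [^]\<^bsub>H\<^esub> m \<in> definable_set H \<phi>"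
    using assms(1,5) H by (simp add: weakly_rational_def)
  moreover have g: "g \<in> carrier G" using assms(4) by (simp add: definable_set_def)
  moreover have "f g [^]\<^bsub>H\<^esub> m = f (g [^]\<^bsub>G\<^esub> m)"
    using iso g H by (intro hom_nat_pow[symmetric]) (auto simp: iso_def)
  ultimately obtain x where x: "x \<in> definable_set G \<phi>" "f (g [^]\<^bsub>G\<^esub> m) = f x"
    using definable_set_iso[OF is_group H iso] by auto
  moreover have "x \<in> carrier G" using x by (simp add: definable_set_def)
  ultimately show ?thesis using f g by (auto dest: inj_onD)
qed

end

theory Submission
  imports Defs "HOL-Number_Theory.Totient"
begin

text \<open>
  The set \<open>S\<close> defined by the formula is closed under conjugation, so by Dietzmann's lemma it suffices
  that a finite \<open>S\<close> consists of elements of finite order. In a finite quotient \<open>G/N\<close>, weak rationality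
  makes the power \<open>(gN)\<^sup>m\<close> of \<open>g \<in> S\<close>, for \<open>m\<close> coprime to \<open>|G/N|\<close>, the image of a word value \<open>h\<close>. The
  set defined by \<open>\<psi>\<close> is open in the profinite topology, and since the complement of the set defined by
  an ena formula is empty or a subgroup, \<open>h\<close> satisfies \<open>\<psi>\<close> whenever \<open>g\<close> does and \<open>N\<close> is small enough.
  Hence all generators of \<open>\<langle>gN\<rangle>\<close> lie in the image of \<open>S\<close>, which bounds the order of \<open>gN\<close> in
  terms of \<open>card S\<close>, independently of \<open>N\<close>.
\<close>

section \<open>Dietzmann's lemma\<close>

definition prod_list_in :: "('a, 'b) monoid_scheme \<Rightarrow> 'a list \<Rightarrow> 'a" where
  "prod_list_in G xs = foldr (\<otimes>\<^bsub>G\<^esub>) xs \<one>\<^bsub>G\<^esub>"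

lemma prod_list_in_simps [simp]:
  "prod_list_in G [] = \<one>\<^bsub>G\<^esub>"
  "prod_list_in G (x # xs) = x \<otimes>\<^bsub>G\<^esub> prod_list_in G xs"
  by (simp_all add: prod_list_in_def)

context group
begin

lemma inv_cancel_left:
  assumes "x \<in> carrier G" "y \<in> carrier G"
  shows "inv x \<otimes> (x \<otimes> y) = y" "x \<otimes> (inv x \<otimes> y) = y"
  using assms by (simp_all flip: m_assoc)

lemma prod_list_in_closed [simp]: "set xs \<subseteq> carrier G \<Longrightarrow> prod_list_in G xs \<in> carrier G"
  by (induction xs) auto

lemma prod_list_in_append:
  "\<lbrakk>set xs \<subseteq> carrier G; set ys \<subseteq> carrier G\<rbrakk>
    \<Longrightarrow> prod_list_in G (xs @ ys) = prod_list_in G xs \<otimes> prod_list_in G ys"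
  by (induction xs) (auto simp: m_assoc)

lemma prod_list_in_replicate: "x \<in> carrier G \<Longrightarrow> prod_list_in G (replicate n x) = x [^] n"
  by (induction n) (auto simp: nat_pow_comm[of x _ 1, simplified])

text \<open>Moving an \<open>a\<close> to the front conjugates the factors that it passes.\<close>

lemma collect_occurrences:
  assumes S: "S \<subseteq> carrier G" "\<And>x y. \<lbrakk>x \<in> S; y \<in> carrier G\<rbrakk> \<Longrightarrow> y \<otimes> x \<otimes> inv y \<in> S"
    and "a \<in> S" "set xs \<subseteq> S" "k \<le> count_list xs a"
  shows "\<exists>ys. set ys \<subseteq> S \<and> length ys + k = length xs \<and>
           prod_list_in G xs = a [^] k \<otimes> prod_list_in G ys"
  using assms(4,5)
proof (induction xs arbitrary: k)
  case (Cons b xs)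
  have a: "a \<in> carrier G" and b: "b \<in> carrier G" and xs: "set xs \<subseteq> S" "set xs \<subseteq> carrier G"
    using S(1) assms(3) Cons.prems by auto
  show ?case
  proof (cases k)
    case 0
    then show ?thesis using Cons.prems b xs by (intro exI[of _ "b # xs"]) simp
  next
    case (Suc l)
    show ?thesis
    proof (cases "b = a")
      case True
      then obtain ys where ys: "set ys \<subseteq> S" "length ys + l = length xs"
        "prod_list_in G xs = a [^] l \<otimes> prod_list_in G ys"
        using Cons.IH[of l] xs Cons.prems Suc by auto
      then have "prod_list_in G ys \<in> carrier G" using S(1) by auto
      then have "prod_list_in G (b # xs) = a [^] k \<otimes> prod_list_in G ys"
        using ys(3) a True unfolding Suc nat_pow_Suc2[OF a] by (simp add: m_assoc)
      then show ?thesis using ys Suc by (intro exI[of _ ys]) simp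
    next
      case False
      then obtain ys where ys: "set ys \<subseteq> S" "length ys + k = length xs"
        "prod_list_in G xs = a [^] k \<otimes> prod_list_in G ys"
        using Cons.IH[of k] xs Cons.prems by auto
      then have P: "prod_list_in G ys \<in> carrier G" using S(1) by auto
      let ?c = "inv (a [^] k) \<otimes> b \<otimes> inv (inv (a [^] k))"
      have "?c \<in> S" using S(2)[of b "inv (a [^] k)"] a Cons.prems by simp
      moreover have "b \<otimes> (a [^] k \<otimes> prod_list_in G ys) = a [^] k \<otimes> (?c \<otimes> prod_list_in G ys)"
        using a b P by (simp add: m_assoc inv_cancel_left)
      ultimately show ?thesis using ys by (intro exI[of _ "?c # ys"]) simp
    qed
  qed
qed auto

text \<open>By pigeonhole, a list longer than the sum of the orders contains some \<open>a\<close>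
  at least \<open>ord a\<close> times. Collecting \<open>ord a\<close> of them at the front gives a
  factor \<open>\<one>\<close>, and the rest is shorter since \<open>ord a > 0\<close>.\<close>

lemma prod_list_in_shorten:
  assumes S: "S \<subseteq> carrier G" "\<And>x y. \<lbrakk>x \<in> S; y \<in> carrier G\<rbrakk> \<Longrightarrow> y \<otimes> x \<otimes> inv y \<in> S"
    and "finite S" and pos: "\<And>x. x \<in> S \<Longrightarrow> ord x > 0"
    and "set xs \<subseteq> S"
  shows "\<exists>ys. set ys \<subseteq> S \<and> length ys \<le> (\<Sum>x\<in>S. ord x) \<and> prod_list_in G ys = prod_list_in G xs"
  using assms(5)
proof (induction "length xs" arbitrary: xs rule: less_induct)
  case less
  show ?case
  proof (cases "length xs \<le> (\<Sum>x\<in>S. ord x)")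
    case False
    have "length xs = (\<Sum>x\<in>S. count_list xs x)"
      using sum_count_set[OF less.prems \<open>finite S\<close>] by simp
    with False have "\<not> (\<forall>x\<in>S. count_list xs x \<le> ord x)" by (metis sum_mono)
    then obtain a where a: "a \<in> S" "ord a \<le> count_list xs a" by force
    obtain ys where ys: "set ys \<subseteq> S" "length ys + ord a = length xs"
      "prod_list_in G xs = a [^] ord a \<otimes> prod_list_in G ys"
      using collect_occurrences[OF S(1) S(2) a(1) less.prems a(2)] by blast
    have "prod_list_in G ys \<in> carrier G" "a \<in> carrier G" using S(1) ys a by auto
    then have "prod_list_in G xs = prod_list_in G ys" using ys(3) by simp
    then show ?thesis using less.hyps[of ys] ys pos[OF a(1)] by auto
  qed (use less.prems in blast)
qed

text \<open>Torsion makes inverses positive powers, so each element of the subgroup is the product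
  of a list over \<open>S\<close>. After shortening, only finitely many lists remain.\<close>

theorem finite_generate_conjugation_closed_torsion:
  assumes S: "S \<subseteq> carrier G" "\<And>x y. \<lbrakk>x \<in> S; y \<in> carrier G\<rbrakk> \<Longrightarrow> y \<otimes> x \<otimes> inv y \<in> S"
    and "finite S" and pos: "\<And>x. x \<in> S \<Longrightarrow> ord x > 0"
  shows "finite (generate G S)"
proof -
  have "\<exists>xs. set xs \<subseteq> S \<and> prod_list_in G xs = g" if "g \<in> generate G S" for g
    using that
  proof induction
    case one
    show ?case by (intro exI[of _ "[]"]) simp
  next
    case (incl h)
    then show ?case using S(1) by (intro exI[of _ "[h]"]) auto
  next
    case (inv h)
    then have h: "h \<in> carrier G" using S(1) by auto
    have "h [^] (ord h - 1) \<otimes> h = \<one>"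
      using h pos[OF inv] pow_ord_eq_1[OF h] nat_pow_Suc[of h "ord h - 1"] by simp
    then have "inv h = h [^] (ord h - 1)" using h inv_equality[of "h [^] (ord h - 1)" h] by simp
    then show ?case using inv h
      by (intro exI[of _ "replicate (ord h - 1) h"]) (auto simp: prod_list_in_replicate)
  next
    case (eng h1 h2)
    then obtain xs ys where "set xs \<subseteq> S" "prod_list_in G xs = h1"
      "set ys \<subseteq> S" "prod_list_in G ys = h2" by blast
    then show ?case using S(1) prod_list_in_append[of xs ys]
      by (intro exI[of _ "xs @ ys"]) auto
  qed
  then have "generate G S \<subseteq> prod_list_in G ` {xs. set xs \<subseteq> S \<and> length xs \<le> (\<Sum>x\<in>S. ord x)}"
    using prod_list_in_shorten[OF S \<open>finite S\<close> pos] by (smt (verit) image_iff mem_Collect_eq subsetI)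
  then show ?thesis
    using finite_lists_length_le[OF \<open>finite S\<close>] by (meson finite_imageI finite_subset)
qed

end

section \<open>Values of words\<close>

text \<open>Assignments are total, so that one \<open>f\<close> serves several words at once; by
  \<open>word_eval_cong\<close> only the letters in the support matter. Lists may be unreduced,
  which permits induction along them.\<close>

fun word_eval :: "('a, 'b) monoid_scheme \<Rightarrow> (nat \<Rightarrow> 'a) \<Rightarrow> (nat \<times> bool) list \<Rightarrow> 'a" where
  "word_eval G f [] = \<one>\<^bsub>G\<^esub>"
| "word_eval G f ((n, b) # w) = (if b then f n else inv\<^bsub>G\<^esub> (f n)) \<otimes>\<^bsub>G\<^esub> word_eval G f w"

lemma gterm_eval_word_gterm: "gterm_eval G e (word_gterm \<sigma> w) = word_eval G (\<lambda>n. e (\<sigma> n)) w"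
  by (induction \<sigma> w rule: word_gterm.induct) auto

lemma word_eval_cong:
  "(\<And>n. n \<in> support w \<Longrightarrow> f n = f' n) \<Longrightarrow> word_eval G f w = word_eval G f' w"
  by (induction G f w rule: word_eval.induct) (auto simp: support_def)

lemma (in group_hom) word_eval_hom:
  "range f \<subseteq> carrier G \<Longrightarrow> word_eval G f w \<in> carrier G \<and> word_eval H (h \<circ> f) w = h (word_eval G f w)"
proof (induction w)
  case (Cons a w)
  then have "f n \<in> carrier G" for n by auto
  then show ?case using Cons by (cases a) auto
qed auto

context group
begin

lemma word_eval_closed [simp]: "range f \<subseteq> carrier G \<Longrightarrow> word_eval G f w \<in> carrier G"
proof (induction w)
  case (Cons a w)
  then have "f n \<in> carrier G" for n by auto
  then show ?case using Cons by (cases a) auto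
qed auto

lemma word_eval_one: "(\<And>n. n \<in> support w \<Longrightarrow> f n = \<one>) \<Longrightarrow> word_eval G f w = \<one>"
  by (induction w) (auto simp: support_def)

lemma word_eval_cancel_cons:
  assumes "range f \<subseteq> carrier G"
  shows "word_eval G f (cancel_cons a w) = word_eval G f (a # w)"
proof (cases w)
  case (Cons b v)
  have f: "f n \<in> carrier G" for n using assms by auto
  show ?thesis
  proof (cases "b = flip a")
    case True
    then show ?thesis using f Cons assms
      by (cases a) (auto simp: flip_def m_assoc[symmetric])
  qed (use Cons in simp)
qed simp

lemma word_eval_mult:
  assumes "range f \<subseteq> carrier G"
  shows "word_eval G f (v \<otimes>\<^bsub>free_group\<^esub> w) = word_eval G f v \<otimes> word_eval G f w"
proof -
  have f: "f n \<in> carrier G" for n using assms by auto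
  have "word_eval G f (foldr cancel_cons v w) = word_eval G f v \<otimes> word_eval G f w"
  proof (induction v)
    case (Cons a v)
    then show ?case using f assms
      by (cases a) (auto simp: word_eval_cancel_cons m_assoc)
  qed (use assms in simp)
  then show ?thesis by (simp add: free_group_def)
qed

text \<open>This is the existence half of the universal property of the free group.\<close>

lemma group_hom_word_eval:
  assumes "range f \<subseteq> carrier G"
  shows "group_hom free_group G (word_eval G f)"
  using assms group_free_group is_group
  by (auto simp: group_hom_def group_hom_axioms_def hom_def word_eval_mult)

definition commutator :: "'a \<Rightarrow> 'a \<Rightarrow> 'a" where
  "commutator a b = inv a \<otimes> inv b \<otimes> a \<otimes> b"

lemma word_eval_commutator_word:
  assumes "range f \<subseteq> carrier G" "v \<in> carrier free_group" "w \<in> carrier free_group"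
  shows "word_eval G f (commutator_word v w) = commutator (word_eval G f v) (word_eval G f w)"
proof -
  interpret F: group_hom free_group G "word_eval G f" using assms(1) by (rule group_hom_word_eval)
  show ?thesis using assms by (simp add: commutator_word_def commutator_def)
qed

lemma word_eval_word_product:
  assumes "range f \<subseteq> carrier G"
  shows "word_eval G f (word_product us) = prod_list_in G (map (word_eval G f) us)"
proof (induction us)
  case Nil
  then show ?case by (simp add: word_product_def free_group_def)
next
  case (Cons u us)
  have "word_product (u # us) = u \<otimes>\<^bsub>free_group\<^esub> word_product us" by (simp add: word_product_def)
  then show ?case using Cons word_eval_mult[OF assms] by simp
qed

lemma conj_iso:
  assumes "g \<in> carrier G"
  shows "(\<lambda>x. g \<otimes> x \<otimes> inv g) \<in> iso G G"
proof -
  have "bij_betw (\<lambda>x. g \<otimes> x \<otimes> inv g) (carrier G) (carrier G)"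
    by (rule bij_betw_byWitness[where f' = "\<lambda>x. inv g \<otimes> x \<otimes> g"])
       (use assms in \<open>auto simp: m_assoc inv_cancel_left\<close>)
  then show ?thesis using assms
    by (auto simp: iso_def hom_def m_assoc inv_cancel_left)
qed

lemma conj_word_eval:
  assumes "range f \<subseteq> carrier G" "g \<in> carrier G"
  shows "g \<otimes> word_eval G f w \<otimes> inv g = word_eval G (\<lambda>n. g \<otimes> f n \<otimes> inv g) w"
proof -
  interpret C: group_hom G G "\<lambda>x. g \<otimes> x \<otimes> inv g"
    using conj_iso[OF assms(2)] is_group by (simp add: group_hom_def group_hom_axioms_def iso_def)
  show ?thesis using C.word_eval_hom[OF assms(1), of w] by (simp add: o_def)
qed

end

lemma outer_commutator_carrier: "outer_commutator u \<Longrightarrow> u \<in> carrier free_group"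
proof (induction rule: outer_commutator.induct)
  case (commutator v w)
  interpret group free_group by (rule group_free_group)
  show ?case using commutator by (simp add: commutator_word_def)
qed (simp add: free_group_def reduced_Cons)

section \<open>Outer commutator words\<close>

context group
begin

lemma commutator_closed [simp]:
  "\<lbrakk>a \<in> carrier G; b \<in> carrier G\<rbrakk> \<Longrightarrow> commutator a b \<in> carrier G"
  by (simp add: commutator_def)

lemma inv_commutator:
  "\<lbrakk>a \<in> carrier G; b \<in> carrier G\<rbrakk> \<Longrightarrow> inv (commutator a b) = commutator b a"
  by (simp add: commutator_def inv_mult_group m_assoc)

text \<open>The set is the preimage of the centralizer of the image of \<open>T\<close> in the
  quotient by \<open>K\<close>, and it is normal because \<open>T\<close> is closed under
  conjugation. The commutator identities below express this without passing to the quotient.\<close>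

lemma normal_centralizer_mod:
  assumes "K \<lhd> G" "T \<subseteq> carrier G"
    and conj: "\<And>t x. \<lbrakk>t \<in> T; x \<in> carrier G\<rbrakk> \<Longrightarrow> x \<otimes> t \<otimes> inv x \<in> T"
  shows "{k \<in> carrier G. \<forall>t\<in>T. commutator k t \<in> K} \<lhd> G"
    (is "?C \<lhd> G")
proof -
  interpret K: normal K G by fact
  have T: "t \<in> carrier G" if "t \<in> T" for t using that assms(2) by auto
  have "a \<otimes> b \<in> ?C" if "a \<in> ?C" "b \<in> ?C" for a b
  proof -
    have "commutator (a \<otimes> b) t = inv b \<otimes> commutator a t \<otimes> b \<otimes> commutator b t" if "t \<in> T" for t
      using \<open>a \<in> ?C\<close> \<open>b \<in> ?C\<close> T[OF that]
      by (simp add: commutator_def inv_mult_group m_assoc inv_cancel_left)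
    then show ?thesis using that by (auto simp: K.inv_op_closed1)
  qed
  moreover have "inv a \<in> ?C" if "a \<in> ?C" for a
  proof -
    have "commutator (inv a) t = a \<otimes> inv (commutator a t) \<otimes> inv a" if "t \<in> T" for t
      using \<open>a \<in> ?C\<close> T[OF that]
      by (simp add: commutator_def inv_mult_group m_assoc inv_cancel_left)
    then show ?thesis using that by (auto simp: K.inv_op_closed2)
  qed
  moreover have "x \<otimes> a \<otimes> inv x \<in> ?C" if "a \<in> ?C" "x \<in> carrier G" for a x
  proof -
    have "commutator (x \<otimes> a \<otimes> inv x) t = x \<otimes> commutator a (inv x \<otimes> t \<otimes> inv (inv x)) \<otimes> inv x"
      if "t \<in> T" for t
      using \<open>a \<in> ?C\<close> \<open>x \<in> carrier G\<close> T[OF that]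
      by (simp add: commutator_def inv_mult_group m_assoc inv_cancel_left)
    moreover have "inv x \<otimes> t \<otimes> inv (inv x) \<in> T" if "t \<in> T" for t
      using conj[OF that, of "inv x"] \<open>x \<in> carrier G\<close> by simp
    ultimately show ?thesis using that by (auto simp: K.inv_op_closed2)
  qed
  moreover have "\<one> \<in> ?C" using T by (simp add: commutator_def)
  ultimately show ?thesis
    unfolding normal_inv_iff by (auto intro!: subgroupI)
qed

text \<open>
  The set of all \<open>h\<close> with all values \<open>u(x, h)\<close> in a normal subgroup \<open>K\<close> is itself a subgroup. For
  \<open>u = [v, t]\<close> with \<open>y\<close> in \<open>v\<close>, the condition says that the values \<open>v(x, h)\<close> centralize all values of
  \<open>t\<close> modulo \<open>K\<close>; here disjointness lets the letters of \<open>v\<close> and \<open>t\<close> vary independently.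
\<close>

lemma outer_commutator_power:
  assumes "outer_commutator u" "K \<lhd> G" "h \<in> carrier G"
    and "\<And>f. range f \<subseteq> carrier G \<Longrightarrow> word_eval G (f(y := h)) u \<in> K"
    and "range f \<subseteq> carrier G"
  shows "word_eval G (f(y := h [^] (j::nat))) u \<in> K"
  using assms
proof (induction arbitrary: K f rule: outer_commutator.induct)
  case (letter n)
  interpret K: normal K G by fact
  show ?case
  proof (cases "n = y")
    case True
    with letter have "h \<in> K" by (auto dest: letter(3))
    then have "h [^] j \<in> K" by (induction j) auto
    with True letter show ?thesis by auto
  next
    case False
    then show ?thesis using letter(3)[of f] letter by auto
  qed
next
  case (commutator v w)
  interpret K: normal K G by fact
  note vw = commutator.hyps(1,2)[THEN outer_commutator_carrier]
  define T where "T u = {word_eval G f u | f. range f \<subseteq> carrier G}" for u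
  have normal: "{k \<in> carrier G. \<forall>t\<in>T u. commutator k t \<in> K} \<lhd> G" for u
  proof (rule normal_centralizer_mod[OF \<open>K \<lhd> G\<close>])
    fix t x assume "t \<in> T u" and x: "x \<in> carrier G"
    then obtain f where f: "range f \<subseteq> carrier G" "t = word_eval G f u" by (auto simp: T_def)
    then have "range (\<lambda>n. x \<otimes> f n \<otimes> inv x) \<subseteq> carrier G" using x by auto
    then show "x \<otimes> t \<otimes> inv x \<in> T u" using conj_word_eval[of f x u] f x by (auto simp: T_def)
  qed (auto simp: T_def)
  have upd: "range (f(y := h)) \<subseteq> carrier G" "range (f(y := h [^] j)) \<subseteq> carrier G"
    if "range f \<subseteq> carrier G" for f
    using that \<open>h \<in> carrier G\<close> by auto
  have indep: "commutator (word_eval G (f(y := h)) v) (word_eval G (f'(y := h)) w) \<in> K"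
    if "range f \<subseteq> carrier G" "range f' \<subseteq> carrier G" for f f'
  proof -
    \<comment> \<open>Gluing \<open>f\<close> on the letters of \<open>v\<close> with
      \<open>f'\<close> elsewhere realizes both values in a single value of the commutator
      word.\<close>
    define g where "g n = (if n \<in> support v then f n else f' n)" for n
    have g: "range g \<subseteq> carrier G" using that by (auto simp: g_def)
    have "word_eval G (g(y := h)) v = word_eval G (f(y := h)) v"
      by (rule word_eval_cong) (simp add: g_def)
    moreover have "word_eval G (g(y := h)) w = word_eval G (f'(y := h)) w"
      using commutator.hyps(3) by (intro word_eval_cong) (auto simp: g_def disjoint_words_def)
    ultimately show ?thesis
      using commutator.prems(3)[OF g] unfolding word_eval_commutator_word[OF upd(1)[OF g] vw] by simp
  qed
  have goal: "commutator (word_eval G (f(y := h [^] j)) v) (word_eval G (f(y := h [^] j)) w) \<in> K"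
  proof (cases "y \<in> support v")
    case True
    then have y: "word_eval G (f(y := a)) w = word_eval G f w" for f a
      using commutator.hyps(3) by (intro word_eval_cong) (auto simp: disjoint_words_def)
    \<comment> \<open>The induction hypothesis is used with the centralizer of the values of
      \<open>w\<close> modulo \<open>K\<close> in place of \<open>K\<close>; this is why the lemma
      allows an arbitrary normal subgroup.\<close>
    have "word_eval G (f(y := h [^] j)) v \<in> {k \<in> carrier G. \<forall>t\<in>T w. commutator k t \<in> K}"
      by (rule commutator.IH(1)[OF normal \<open>h \<in> carrier G\<close>])
         (use indep upd y commutator.prems(4) in \<open>auto simp: T_def simp del: fun_upd_apply\<close>)
    then show ?thesis using commutator.prems(4) by (auto simp: T_def y)
  next
    case False
    then have y: "word_eval G (f(y := a)) v = word_eval G f v" for f a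
      by (intro word_eval_cong) auto
    \<comment> \<open>In \<open>normal\<close> the varying element is the first entry of the
      commutator. When \<open>y\<close> is not in \<open>v\<close>, the varying word is
      \<open>w\<close>, so the commutators are inverted.\<close>
    have swap: "commutator b a \<in> K" if "commutator a b \<in> K" "a \<in> carrier G" "b \<in> carrier G" for a b
      using K.m_inv_closed[OF that(1)] inv_commutator[OF that(2,3)] by simp
    have "word_eval G (f(y := h [^] j)) w \<in> {k \<in> carrier G. \<forall>t\<in>T v. commutator k t \<in> K}"
    proof (rule commutator.IH(2)[OF normal \<open>h \<in> carrier G\<close>])
      fix f :: "nat \<Rightarrow> 'a" assume f: "range f \<subseteq> carrier G"
      have "commutator (word_eval G (f(y := h)) w) t \<in> K" if t: "t \<in> T v" for t
      proof -
        obtain f' where f': "range f' \<subseteq> carrier G" "t = word_eval G f' v" using t by (auto simp: T_def)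
        have "commutator t (word_eval G (f(y := h)) w) \<in> K" using indep[OF f'(1) f] by (simp add: y f'(2))
        from swap[OF this] f' show ?thesis using word_eval_closed[OF upd(1)[OF f]] by simp
      qed
      then show "word_eval G (f(y := h)) w \<in> {k \<in> carrier G. \<forall>t\<in>T v. commutator k t \<in> K}"
        using word_eval_closed[OF upd(1)[OF f]] by simp
    qed (rule commutator.prems(4))
    then have "commutator (word_eval G (f(y := h [^] j)) w) (word_eval G f v) \<in> K"
      using commutator.prems(4) by (auto simp: T_def)
    from swap[OF this] show ?thesis
      using commutator.prems(4) word_eval_closed[OF upd(2)[OF commutator.prems(4)]] by (simp add: y)
  qed
  then show ?case
    unfolding word_eval_commutator_word[OF upd(2)[OF commutator.prems(4)] vw] .
qed

text \<open>By disjointness \<open>y\<close> occurs in at most one factor \<open>u\<close>. The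
  hypothesis forces all values of \<open>u\<close> at \<open>h\<close> to be trivial, so
  \<open>outer_commutator_power\<close> applies with \<open>K = {\<one>}\<close>, while the other
  factors do not see the change from \<open>h\<close> to its power.\<close>

lemma outer_commutator_product_power:
  assumes us: "\<forall>u\<in>set us. outer_commutator u" "sorted_wrt disjoint_words us"
    and h: "h \<in> carrier G"
    and triv: "\<And>f. range f \<subseteq> carrier G \<Longrightarrow> word_eval G (f(y := h)) (word_product us) = \<one>"
    and f: "range f \<subseteq> carrier G"
  shows "word_eval G (f(y := h [^] (j::nat))) (word_product us) = \<one>"
proof (cases "\<exists>u\<in>set us. y \<in> support u")
  case True
  then obtain as u bs where split: "us = as @ u # bs" and y: "y \<in> support u"
    by (meson split_list)
  have disj: "support u' \<inter> support u = {}" if "u' \<in> set as \<union> set bs" for u'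
    using us(2) that unfolding split by (auto simp: sorted_wrt_append disjoint_words_def)
  have upd: "range (f(y := h [^] i)) \<subseteq> carrier G" if "range f \<subseteq> carrier G" for f and i :: nat
    using that h by auto
  have eval: "word_eval G f (word_product us) =
      prod_list_in G (map (word_eval G f) as) \<otimes>
        (word_eval G f u \<otimes> prod_list_in G (map (word_eval G f) bs))"
    if "range f \<subseteq> carrier G" for f
    using that prod_list_in_append[of "map (word_eval G f) as" "map (word_eval G f) (u # bs)"]
    by (simp add: word_eval_word_product split image_subset_iff)
  have ones: "prod_list_in G (map (word_eval G f) vs) = \<one>"
    if "\<And>v. v \<in> set vs \<Longrightarrow> word_eval G f v = \<one>" for f vs
    using that by (induction vs) auto
  have u: "word_eval G (f(y := h)) u = \<one>" if "range f \<subseteq> carrier G" for f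
  proof -
    \<comment> \<open>Setting the letters outside \<open>u\<close> to \<open>\<one>\<close> kills
      all other factors and isolates the value of \<open>u\<close>.\<close>
    define g where "g n = (if n \<in> support u then f n else \<one>)" for n
    have g: "range g \<subseteq> carrier G" using that by (auto simp: g_def)
    have "word_eval G (g(y := h)) v = \<one>" if "v \<in> set as \<union> set bs" for v
      using disj[OF that] y by (intro word_eval_one) (auto simp: g_def)
    moreover have "word_eval G (g(y := h)) u = word_eval G (f(y := h)) u"
      by (intro word_eval_cong) (auto simp: g_def)
    ultimately show ?thesis
      using triv[OF g] eval[OF upd[OF g, of 1]] h upd[OF that, of 1] by (simp add: ones)
  qed
  have u': "word_eval G (f(y := h [^] j)) u \<in> {\<one>}"
    using us(1) h f u by (intro outer_commutator_power) (auto simp: split one_is_normal)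
  have "prod_list_in G (map (word_eval G (f(y := h [^] j))) vs) =
      prod_list_in G (map (word_eval G (f(y := h))) vs)"
    if "set vs \<subseteq> set as \<union> set bs" for vs
    using that disj y by (intro arg_cong[where f = "prod_list_in G"] map_cong word_eval_cong) auto
  then show ?thesis
    using u' u[OF f] triv[OF f] eval[OF upd[OF f, of 1]] eval[OF upd[OF f, of j]] h by simp
next
  case False
  have "prod_list_in G (map (word_eval G (f(y := h [^] j))) us) =
      prod_list_in G (map (word_eval G (f(y := h))) us)"
    using False by (intro arg_cong[where f = "prod_list_in G"] map_cong word_eval_cong) auto
  moreover have "range (f(y := h)) \<subseteq> carrier G" "range (f(y := h [^] j)) \<subseteq> carrier G"
    using f h by auto
  ultimately show ?thesis using triv[OF f] by (simp add: word_eval_word_product)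
qed

end

section \<open>The sets defined by the formulae\<close>

context group
begin

text \<open>The formula \<open>\<chi>\<close> reads no letter outside \<open>A\<close>, so the
  witnesses can be extended by \<open>\<one>\<close> to a total assignment, as
  \<open>word_eval\<close> expects.\<close>

lemma sat_exists_letters_range:
  assumes "finite A" "free_vars \<chi> \<subseteq> insert FreeVar (LetterVar ` A)"
  shows "sat G ((\<lambda>_. \<one>)(FreeVar := g)) (exists_letters A \<chi>) \<longleftrightarrow>
    (\<exists>f. range f \<subseteq> carrier G \<and> sat G (case_var g f) \<chi>)"
proof -
  define E where "E f = (\<lambda>n. if n \<in> A then f n else \<one>)" for f
  have env: "(\<lambda>x. case x of FreeVar \<Rightarrow> ((\<lambda>_. \<one>)(FreeVar := g)) FreeVar
      | LetterVar n \<Rightarrow> (if n \<in> A then f n else ((\<lambda>_. \<one>)(FreeVar := g)) (LetterVar n))) = case_var g (E f)"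
    for f
    by (rule ext) (simp add: E_def split: var.split)
  have sat: "sat G (case_var g (E f)) \<chi> \<longleftrightarrow> sat G (case_var g f) \<chi>" for f
  proof (rule sat_cong)
    fix x assume "x \<in> free_vars \<chi>"
    then show "case_var g (E f) x = case_var g f x"
      using assms(2) by (cases x) (auto simp: E_def)
  qed
  have "(\<exists>f. (\<forall>n\<in>A. f n \<in> carrier G) \<and> sat G (case_var g (E f)) \<chi>) \<longleftrightarrow>
      (\<exists>f. range f \<subseteq> carrier G \<and> sat G (case_var g f) \<chi>)"
  proof
    assume "\<exists>f. (\<forall>n\<in>A. f n \<in> carrier G) \<and> sat G (case_var g (E f)) \<chi>"
    then obtain f where "\<forall>n\<in>A. f n \<in> carrier G" "sat G (case_var g (E f)) \<chi>" by blast
    moreover from this have "range (E f) \<subseteq> carrier G" by (auto simp: E_def)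
    ultimately show "\<exists>f. range f \<subseteq> carrier G \<and> sat G (case_var g f) \<chi>" by blast
  next
    assume "\<exists>f. range f \<subseteq> carrier G \<and> sat G (case_var g f) \<chi>"
    then obtain f where "range f \<subseteq> carrier G" "sat G (case_var g f) \<chi>" by blast
    then show "\<exists>f. (\<forall>n\<in>A. f n \<in> carrier G) \<and> sat G (case_var g (E f)) \<chi>"
      by (intro exI[of _ f]) (auto simp: sat)
  qed
  then show ?thesis unfolding sat_exists_letters[OF assms(1)] env .
qed

lemma definable_set_word_formula:
  "definable_set G (word_formula w) = {word_eval G f w | f. range f \<subseteq> carrier G}"
proof -
  have fv: "free_vars (Eq (word_gterm LetterVar w) (VarT FreeVar))
      \<subseteq> insert FreeVar (LetterVar ` support w)"
    by (auto simp: gterm_vars_word_gterm)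
  have sat: "sat G ((\<lambda>_. \<one>)(FreeVar := g)) (word_formula w) \<longleftrightarrow>
      (\<exists>f. range f \<subseteq> carrier G \<and> word_eval G f w = g)" for g
    unfolding word_formula_def sat_exists_letters_range[OF finite_support fv]
    by (simp add: gterm_eval_word_gterm)
  show ?thesis unfolding definable_set_def sat using word_eval_closed by blast
qed

lemma definable_set_ena_formula:
  "definable_set G (ena_formula w y) =
     {g \<in> carrier G. \<exists>f. range f \<subseteq> carrier G \<and> word_eval G (f(y := g)) w \<noteq> \<one>}"
proof -
  have env: "(\<lambda>n. case_var g f ((LetterVar(y := FreeVar)) n)) = f(y := g)" for g and f :: "nat \<Rightarrow> 'a"
    by auto
  have fin: "finite (support w - {y})" by simp
  have fv: "free_vars (Neg (Eq (word_gterm (LetterVar(y := FreeVar)) w) OneT))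
      \<subseteq> insert FreeVar (LetterVar ` (support w - {y}))"
    by (auto simp: gterm_vars_word_gterm)
  have sat: "sat G ((\<lambda>_. \<one>)(FreeVar := g)) (ena_formula w y) \<longleftrightarrow>
      (\<exists>f. range f \<subseteq> carrier G \<and> word_eval G (f(y := g)) w \<noteq> \<one>)" for g
    unfolding ena_formula_def sat_exists_letters_range[OF fin fv] sat.simps gterm_eval_word_gterm env
    by simp
  show ?thesis unfolding definable_set_def sat ..
qed

text \<open>Formulae carry no parameters, so the sets they define are invariant under automorphisms,
  in particular under inner ones.\<close>

lemma definable_set_conj_closed:
  assumes "x \<in> definable_set G \<phi>" "g \<in> carrier G"
  shows "g \<otimes> x \<otimes> inv g \<in> definable_set G \<phi>"
  using definable_set_iso[OF is_group is_group conj_iso[OF assms(2)], of \<phi>] assms(1) by blast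

lemma definable_set_subset: "definable_set G \<phi> \<subseteq> carrier G"
  by (auto simp: definable_set_def)

lemma definable_set_Disj: "definable_set G (Disj \<phi> \<psi>) = definable_set G \<phi> \<union> definable_set G \<psi>"
  by (auto simp: definable_set_def)

lemma definable_set_Conj: "definable_set G (Conj \<phi> \<psi>) = definable_set G \<phi> \<inter> definable_set G \<psi>"
  by (auto simp: definable_set_def)

end

section \<open>Finite quotients\<close>

context group
begin

lemma normal_Int: "\<lbrakk>M \<lhd> G; N \<lhd> G\<rbrakk> \<Longrightarrow> M \<inter> N \<lhd> G"
  by (auto simp: normal_inv_iff intro: subgroups_Inter_pair)

lemma r_coset_Int:
  assumes "subgroup M G" "subgroup N G" "x \<in> carrier G"
  shows "(M \<inter> N) #> x = (M #> x) \<inter> (N #> x)"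
proof -
  have "a = b" if "a \<otimes> x = b \<otimes> x" "a \<in> M" "b \<in> N" for a b
    using that assms by (metis right_cancel subgroup.mem_carrier)
  then show ?thesis by (fastforce simp: r_coset_def)
qed

text \<open>Each coset of the intersection is the intersection of a coset of \<open>M\<close> with a
  coset of \<open>N\<close>.\<close>

lemma finite_rcosets_Int:
  assumes "subgroup M G" "subgroup N G" "finite (rcosets M)" "finite (rcosets N)"
  shows "finite (rcosets (M \<inter> N))"
proof (rule finite_subset)
  show "rcosets (M \<inter> N) \<subseteq> (\<lambda>(A, B). A \<inter> B) ` ((rcosets M) \<times> (rcosets N))"
    using r_coset_Int[OF assms(1,2)] by (fastforce simp: RCOSETS_def)
qed (use assms in simp)

lemma finite_rcosets_self: "finite (rcosets (carrier G))"
proof (rule finite_subset)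
  show "rcosets (carrier G) \<subseteq> {carrier G}"
    using coset_join2[OF _ subgroup_self] by (auto simp: RCOSETS_def)
qed simp

lemma r_coset_eq_mono:
  assumes "subgroup M G" "subgroup N G" "M \<subseteq> N" "x \<in> carrier G" "y \<in> carrier G" "M #> x = M #> y"
  shows "N #> x = N #> y"
proof -
  have "y \<in> N #> x" using repr_independenceD[OF assms(1,5,6)] assms(3) by (auto simp: r_coset_def)
  then show ?thesis using repr_independence[OF _ assms(4,2)] by simp
qed

text \<open>This follows from Lagrange's theorem. An infinite group has \<open>order\<close> 0, and
  congruence modulo 0 is equality.\<close>

lemma nat_pow_cong_order:
  assumes "x \<in> carrier G" "[i = j] (mod order G)"
  shows "x [^] i = x [^] (j::nat)"
proof -
  have "x [^] k = x [^] (k mod order G)" for k :: nat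
  proof -
    have "x [^] (order G * (k div order G)) = \<one>"
      using pow_order_eq_1[OF assms(1)] by (simp add: assms(1) flip: nat_pow_pow)
    then have "x [^] (order G * (k div order G) + k mod order G) = x [^] (k mod order G)"
      using assms(1) by (simp only: nat_pow_mult[symmetric] nat_pow_closed l_one)
    then show ?thesis by simp
  qed
  then show ?thesis using assms(2) by (metis cong_def)
qed

lemma finite_quotient:
  assumes "N \<lhd> G" "finite (rcosets N)"
  shows "group (G Mod N)" "finite (carrier (G Mod N))"
  using assms(2) by (simp_all add: FactGroup_def normal.factorgroup_is_group[OF assms(1), unfolded FactGroup_def])

section \<open>Transfer between the group and its finite quotients\<close>

lemma group_hom_quotient: "N \<lhd> G \<Longrightarrow> group_hom G (G Mod N) (\<lambda>x. N #> x)"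
  by (simp add: group_hom_def group_hom_axioms_def is_group
      normal.factorgroup_is_group normal.r_coset_hom_Mod)

text \<open>The word values in \<open>G Mod N\<close> are exactly the images of the word values in
  \<open>G\<close>. So \<open>g\<close> can be pushed to the finite quotient, raised to the power
  there by weak rationality, and the result lifted to a word value in \<open>G\<close>.\<close>

lemma weakly_rational_coset:
  assumes "disjunction_of weakly_rational_word_formula \<phi>"
    and N: "N \<lhd> G" "finite (rcosets N)"
    and "g \<in> definable_set G \<phi>" "coprime m (order (G Mod N))"
  shows "\<exists>h\<in>definable_set G \<phi>. N #> h = N #> (g [^] m)"
  using assms(1,4)
proof induction
  case (base \<phi>)
  then obtain w where w: "weakly_rational \<phi>" "\<phi> = word_formula w"
    by (auto simp: weakly_rational_word_formula_def)
  interpret Q: group_hom G "G Mod N" "\<lambda>x. N #> x" using N(1) by (rule group_hom_quotient)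
  have g: "g \<in> carrier G" using base definable_set_subset by auto
  obtain f where f: "range f \<subseteq> carrier G" "g = word_eval G f w"
    using base.prems by (auto simp: w definable_set_word_formula)
  have "range ((\<lambda>x. N #> x) \<circ> f) \<subseteq> carrier (G Mod N)" using f by auto
  then have "N #> g \<in> definable_set (G Mod N) \<phi>"
    using Q.word_eval_hom[OF f(1), of w] unfolding w(2) Q.H.definable_set_word_formula f(2)
    by blast
  then have "(N #> g) [^]\<^bsub>G Mod N\<^esub> m \<in> definable_set (G Mod N) \<phi>"
    using weakly_rationalD[OF w(1) finite_quotient[OF N]] assms(5) by blast
  then obtain F where F: "range F \<subseteq> carrier (G Mod N)" "N #> (g [^] m) = word_eval (G Mod N) F w"
    using normal.FactGroup_pow[OF N(1) g] by (auto simp: w Q.H.definable_set_word_formula)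
  \<comment> \<open>The lift is made letter by letter, by choosing a representative of each coset
    \<open>F n\<close>.\<close>
  have "\<exists>x\<in>carrier G. F n = N #> x" for n
    using F(1) by (auto simp: FactGroup_def RCOSETS_def)
  then obtain f' where f': "\<And>n. f' n \<in> carrier G" "\<And>n. F n = N #> f' n" by metis
  then have "range f' \<subseteq> carrier G" "F = (\<lambda>x. N #> x) \<circ> f'" by auto
  then show ?case
    using F(2) Q.word_eval_hom[of f' w] unfolding w(2) definable_set_word_formula by blast
next
  case (disj \<phi> \<psi>)
  then show ?case by (auto simp: definable_set_Disj)
qed

end

text \<open>
  The words in question vanish on a set of elements closed under powers, so membership of \<open>g\<close> in
  the set defined by the formula is inherited by every \<open>h\<close> a power of which is close to \<open>g\<close>.
\<close>

lemma positive_combination_coset: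
  assumes "positive_combination_of ena_outer_product_formula \<psi>" "residually_finite G"
    and "g \<in> definable_set G \<psi>"
  shows "\<exists>N. N \<lhd> G \<and> finite (rcosets\<^bsub>G\<^esub> N) \<and>
     (\<forall>h\<in>carrier G. \<forall>j::nat. N #>\<^bsub>G\<^esub> (h [^]\<^bsub>G\<^esub> j) = N #>\<^bsub>G\<^esub> g \<longrightarrow> h \<in> definable_set G \<psi>)"
  using assms(1,3)
proof induction
  case (base \<psi>)
  interpret group G using assms(2) by (simp add: residually_finite_def)
  obtain us y where us: "\<forall>u\<in>set us. outer_commutator u" "sorted_wrt disjoint_words us"
    and \<psi>: "\<psi> = ena_formula (word_product us) y"
    using base.hyps by (auto simp: ena_outer_product_formula_def)
  let ?w = "word_product us"
  obtain f where g: "g \<in> carrier G" and f: "range f \<subseteq> carrier G" "word_eval G (f(y := g)) ?w \<noteq> \<one>\<^bsub>G\<^esub>"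
    using base.prems by (auto simp: \<psi> definable_set_ena_formula)
  have upd: "range (f(y := x)) \<subseteq> carrier G" if "x \<in> carrier G" for x using f(1) that by auto
  \<comment> \<open>Residual finiteness separates one nontrivial value witnessing the formula at
    \<open>g\<close> from \<open>\<one>\<close>.\<close>
  obtain N where N: "N \<lhd> G" "finite (rcosets\<^bsub>G\<^esub> N)" "word_eval G (f(y := g)) ?w \<notin> N"
    using assms(2) f(2) word_eval_closed[OF upd[OF g]] by (metis residually_finite_def)
  interpret Q: group_hom G "G Mod N" "\<lambda>x. N #>\<^bsub>G\<^esub> x" using N(1) by (rule group_hom_quotient)
  have sub: "subgroup N G" using N(1) by (rule normal_imp_subgroup)
  have "h \<in> definable_set G \<psi>"
    if h: "h \<in> carrier G" and eq: "N #>\<^bsub>G\<^esub> (h [^]\<^bsub>G\<^esub> (j::nat)) = N #>\<^bsub>G\<^esub> g" for h j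
  proof (rule ccontr)
    assume "h \<notin> definable_set G \<psi>"
    \<comment> \<open>If \<open>h\<close> fails the formula, all values at \<open>h\<close> vanish,
      hence also those at its powers. But modulo \<open>N\<close> the power agrees with
      \<open>g\<close>, whose value lies outside \<open>N\<close>.\<close>
    then have "word_eval G (f(y := h [^]\<^bsub>G\<^esub> j)) ?w = \<one>\<^bsub>G\<^esub>"
      using h f(1) by (intro outer_commutator_product_power us)
        (auto simp: \<psi> definable_set_ena_formula)
    moreover have "(\<lambda>x. N #>\<^bsub>G\<^esub> x) \<circ> (f(y := h [^]\<^bsub>G\<^esub> j)) = (\<lambda>x. N #>\<^bsub>G\<^esub> x) \<circ> (f(y := g))"
      using eq by (auto simp: fun_eq_iff)
    ultimately have "N #>\<^bsub>G\<^esub> \<one>\<^bsub>G\<^esub> = N #>\<^bsub>G\<^esub> word_eval G (f(y := g)) ?w"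
      using Q.word_eval_hom[OF upd[OF g], of ?w] Q.word_eval_hom[OF upd[of "h [^]\<^bsub>G\<^esub> j"], of ?w] h
      by simp
    then have "word_eval G (f(y := g)) ?w \<in> N #>\<^bsub>G\<^esub> \<one>\<^bsub>G\<^esub>"
      using repr_independenceD[OF sub word_eval_closed[OF upd[OF g]]] by blast
    then show False using N(3) sub by (simp add: subgroup.subset)
  qed
  then show ?case using N by blast
next
  case (conj \<phi> \<psi>)
  interpret group G using assms(2) by (simp add: residually_finite_def)
  let ?P = "\<lambda>N \<phi>. N \<lhd> G \<and> finite (rcosets\<^bsub>G\<^esub> N) \<and>
     (\<forall>h\<in>carrier G. \<forall>j::nat. N #>\<^bsub>G\<^esub> (h [^]\<^bsub>G\<^esub> j) = N #>\<^bsub>G\<^esub> g \<longrightarrow> h \<in> definable_set G \<phi>)"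
  have g: "g \<in> carrier G" using conj.prems definable_set_subset by auto
  obtain M N where MN: "?P M \<phi>" "?P N \<psi>" using conj by (auto simp: definable_set_Conj)
  then have sub: "subgroup M G" "subgroup N G" by (auto intro: normal_imp_subgroup)
  then have sub': "subgroup (M \<inter> N) G" by (rule subgroups_Inter_pair)
  show ?case
  proof (intro exI[of _ "M \<inter> N"] conjI ballI allI impI)
    show "M \<inter> N \<lhd> G" "finite (rcosets\<^bsub>G\<^esub> (M \<inter> N))"
      using MN normal_Int finite_rcosets_Int[OF sub] by auto
    fix h and j :: nat
    assume h: "h \<in> carrier G" and eq: "M \<inter> N #>\<^bsub>G\<^esub> (h [^]\<^bsub>G\<^esub> j) = M \<inter> N #>\<^bsub>G\<^esub> g"
    have "M #>\<^bsub>G\<^esub> (h [^]\<^bsub>G\<^esub> j) = M #>\<^bsub>G\<^esub> g" "N #>\<^bsub>G\<^esub> (h [^]\<^bsub>G\<^esub> j) = N #>\<^bsub>G\<^esub> g"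
      using r_coset_eq_mono[OF sub' sub(1) Int_lower1 _ g eq]
        r_coset_eq_mono[OF sub' sub(2) Int_lower2 _ g eq] h by auto
    then show "h \<in> definable_set G (Conj \<phi> \<psi>)" using MN h by (auto simp: definable_set_Conj)
  qed
next
  case (disj \<phi> \<psi>)
  interpret group G using assms(2) by (simp add: residually_finite_def)
  have sub: "definable_set G \<phi> \<subseteq> definable_set G (Disj \<phi> \<psi>)"
    "definable_set G \<psi> \<subseteq> definable_set G (Disj \<phi> \<psi>)"
    by (auto simp: definable_set_Disj)
  from disj.prems consider "g \<in> definable_set G \<phi>" | "g \<in> definable_set G \<psi>"
    by (auto simp: definable_set_Disj)
  then show ?case
  proof cases
    case 1
    then show ?thesis using disj.IH(1) sub(1) by blast
  next
    case 2
    then show ?thesis using disj.IH(2) sub(2) by blast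
  qed
qed

section \<open>Torsion\<close>

text \<open>If \<open>p ^ k\<close> is the exact power of \<open>p\<close> in \<open>n\<close>, then
  \<open>p ^ (k - 1) * (p - 1) \<le> s\<close>. Hence \<open>p ^ (k - 1) \<le> s\<close> and
  \<open>p \<le> s + 1\<close>, so \<open>p ^ k \<le> s * (s + 1)\<close> divides the
  factorial.\<close>

lemma totient_le_imp_dvd_fact:
  assumes "n > 0" "totient n \<le> s"
  shows "n dvd fact (s * (s + 1))"
proof (rule multiplicity_le_imp_dvd)
  fix p :: nat assume p: "Factorial_Ring.prime p"
  define k where "k = multiplicity p n"
  show "multiplicity p n \<le> multiplicity p (fact (s * (s + 1)))"
  proof (cases "k = 0")
    case False
    have "totient (p ^ k) \<le> s"
      using totient_dvd_mono[OF multiplicity_dvd[of p n] assms(1)] assms(2) by (simp add: k_def)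
    then have le: "p ^ (k - 1) * (p - 1) \<le> s" using totient_prime_power[OF p] False by simp
    have "p \<ge> 2" using p by (rule prime_ge_2_nat)
    then have "p - 1 > 0" "p ^ (k - 1) > 0" by auto
    then have "p ^ (k - 1) * 1 \<le> p ^ (k - 1) * (p - 1)" "1 * (p - 1) \<le> p ^ (k - 1) * (p - 1)"
      by (auto intro: mult_le_mono)
    then have "p ^ (k - 1) \<le> s" "p \<le> s + 1" using le by linarith+
    then have "p ^ (k - 1) * p \<le> s * (s + 1)" by (rule mult_le_mono)
    then have "p ^ k \<le> s * (s + 1)" using False by (cases k) (auto simp: mult.commute)
    then have "p ^ k dvd fact (s * (s + 1))" using \<open>p \<ge> 2\<close> by (intro dvd_fact) auto
    then show ?thesis using p unfolding k_def[symmetric]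
      by (intro multiplicity_geI) (auto simp: prime_gt_1_nat)
  qed (simp add: k_def)
qed (use assms in auto)

text \<open>Units modulo \<open>n\<close> lift to units modulo \<open>M\<close>: take for \<open>t\<close> the product of the primes dividing
  \<open>M\<close> but not \<open>a\<close>.\<close>

lemma coprime_lift:
  fixes a n M :: nat
  assumes "coprime a n" "M > 0"
  shows "\<exists>t. coprime (a + n * t) M"
proof
  let ?A = "{p \<in> prime_factors M. \<not> p dvd a}"
  show "coprime (a + n * \<Prod>?A) M"
  proof (rule ccontr)
    assume "\<not> coprime (a + n * \<Prod>?A) M"
    then have "gcd (a + n * \<Prod>?A) M \<noteq> 1" by (simp add: coprime_iff_gcd_eq_1)
    then obtain p where p: "Factorial_Ring.prime p" "p dvd gcd (a + n * \<Prod>?A) M"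
      using prime_factor_nat by blast
    then have dvd: "p dvd a + n * \<Prod>?A" "p dvd M" by simp_all
    show False
    \<comment> \<open>In either case the prime \<open>p\<close> divides exactly one of the two
      summands \<open>a\<close> and \<open>n * \<Prod>?A\<close>.\<close>
    proof (cases "p dvd a")
      case True
      then have "p dvd n * \<Prod>?A" using dvd(1) by (simp only: dvd_add_right_iff)
      moreover have "\<not> p dvd n"
        using coprime_common_divisor[OF assms(1) True] p(1) not_prime_unit by metis
      ultimately have "p dvd \<Prod>?A" using prime_dvd_mult_iff[OF p(1)] by blast
      then obtain q where q: "q \<in> ?A" "p dvd q"
        using prime_dvd_prod_iff[OF _ p(1), of ?A "\<lambda>q. q"] by (auto simp del: mem_Collect_eq)
      then have "p = q" using primes_dvd_imp_eq[OF p(1)] by (simp add: in_prime_factors_iff)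
      then show False using True q(1) by simp
    next
      case False
      then have "p \<in> ?A" using p(1) dvd(2) assms(2) by (simp add: in_prime_factors_iff)
      then have "p dvd \<Prod>?A" using dvd_prodI[of ?A p "\<lambda>q. q"] by simp
      then have "p dvd n * \<Prod>?A" by (rule dvd_mult)
      then show False using False dvd(1) by (simp only: dvd_add_left_iff)
    qed
  qed
qed

text \<open>Weak rationality is required here only of the images of \<open>S\<close> in sufficiently
  deep finite quotients. The depth \<open>N\<^sub>0\<close> may depend on \<open>g\<close> but not
  on \<open>m\<close>, which makes the property pass to unions.\<close>

definition coset_rational :: "('a, 'b) monoid_scheme \<Rightarrow> 'a set \<Rightarrow> bool" where
  "coset_rational G S \<longleftrightarrow> (\<forall>g\<in>S. \<exists>N\<^sub>0. N\<^sub>0 \<lhd> G \<and> finite (rcosets\<^bsub>G\<^esub> N\<^sub>0) \<and>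
     (\<forall>N. N \<lhd> G \<longrightarrow> finite (rcosets\<^bsub>G\<^esub> N) \<longrightarrow> N \<subseteq> N\<^sub>0 \<longrightarrow>
       (\<forall>m. coprime m (order (G Mod N)) \<longrightarrow> (\<exists>h\<in>S. N #>\<^bsub>G\<^esub> h = N #>\<^bsub>G\<^esub> (g [^]\<^bsub>G\<^esub> m)))))"

text \<open>
  In a finite quotient, if the image of \<open>g\<close> has order \<open>n\<close>, its powers with exponent a unit modulo
  \<open>n\<close> are images of elements of \<open>S\<close>. Hence \<open>totient n\<close> is at most \<open>card S\<close>, which bounds \<open>n\<close>
  independently of the quotient.
\<close>

lemma coset_rational_torsion:
  assumes "residually_finite G" "S \<subseteq> carrier G" "finite S" "coset_rational G S" "g \<in> S"
  shows "group.ord G g > 0"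
proof -
  interpret group G using assms(1) by (simp add: residually_finite_def)
  \<comment> \<open>The exponent comes from \<open>totient_le_imp_dvd_fact\<close> and depends only
    on \<open>card S\<close>, so it can be fixed before any quotient is chosen.\<close>
  define L :: nat where "L = fact (card S * (card S + 1))"
  have g: "g \<in> carrier G" using assms by auto
  have "g [^]\<^bsub>G\<^esub> L = \<one>\<^bsub>G\<^esub>"
  proof (rule ccontr)
    assume "g [^]\<^bsub>G\<^esub> L \<noteq> \<one>\<^bsub>G\<^esub>"
    then obtain N\<^sub>1 where N1: "N\<^sub>1 \<lhd> G" "finite (rcosets\<^bsub>G\<^esub> N\<^sub>1)" "g [^]\<^bsub>G\<^esub> L \<notin> N\<^sub>1"
      using assms(1) g by (metis residually_finite_def nat_pow_closed)
    obtain N\<^sub>0 where N0: "N\<^sub>0 \<lhd> G" "finite (rcosets\<^bsub>G\<^esub> N\<^sub>0)"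
      and S: "\<And>N m. \<lbrakk>N \<lhd> G; finite (rcosets\<^bsub>G\<^esub> N); N \<subseteq> N\<^sub>0; coprime m (order (G Mod N))\<rbrakk>
        \<Longrightarrow> \<exists>h\<in>S. N #>\<^bsub>G\<^esub> h = N #>\<^bsub>G\<^esub> (g [^]\<^bsub>G\<^esub> m)"
      using assms(4,5) unfolding coset_rational_def by metis
    \<comment> \<open>Below \<open>N\<^sub>0\<close> the rationality condition is available; below
      \<open>N\<^sub>1\<close> the element \<open>g [^] L\<close> stays nontrivial in the
      quotient.\<close>
    define N where "N = N\<^sub>0 \<inter> N\<^sub>1"
    have sub: "N \<subseteq> N\<^sub>0" by (simp add: N_def)
    have N: "N \<lhd> G" "finite (rcosets\<^bsub>G\<^esub> N)"
      using N0 N1 unfolding N_def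
      by (auto intro: normal_Int finite_rcosets_Int normal_imp_subgroup)
    interpret Q: group "G Mod N" by (rule finite_quotient[OF N])
    let ?x = "N #>\<^bsub>G\<^esub> g"
    define n where "n = Q.ord ?x"
    have x: "?x \<in> carrier (G Mod N)" using g by (auto simp: FactGroup_def RCOSETS_def)
    have pow: "?x [^]\<^bsub>G Mod N\<^esub> m = N #>\<^bsub>G\<^esub> (g [^]\<^bsub>G\<^esub> m)" for m :: nat
      using normal.FactGroup_pow[OF N(1) g] .
    have n: "n > 0" using Q.ord_ge_1[OF finite_quotient(2)[OF N] x] by (simp add: n_def)
    have "(\<lambda>a. ?x [^]\<^bsub>G Mod N\<^esub> a) ` totatives n \<subseteq> (\<lambda>h. N #>\<^bsub>G\<^esub> h) ` S"
    proof safe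
      fix a assume "a \<in> totatives n"
      then have "coprime a n" by (simp add: in_totatives_iff)
      moreover have "order (G Mod N) > 0"
        using finite_quotient(2)[OF N] Q.order_gt_0_iff_finite by simp
      \<comment> \<open>The exponent must be coprime to the order of the whole quotient, not just to
        \<open>n\<close>. Adding a multiple of \<open>n\<close> achieves this and leaves the power
        of \<open>?x\<close> unchanged.\<close>
      ultimately obtain t where "coprime (a + n * t) (order (G Mod N))"
        using coprime_lift by blast
      then obtain h where h: "h \<in> S" "N #>\<^bsub>G\<^esub> h = ?x [^]\<^bsub>G Mod N\<^esub> (a + n * t)"
        using S[OF N sub] unfolding pow by blast
      have "?x [^]\<^bsub>G Mod N\<^esub> (n * t) = \<one>\<^bsub>G Mod N\<^esub>"
        using Q.pow_eq_id[OF x] by (simp add: n_def)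
      then have "?x [^]\<^bsub>G Mod N\<^esub> (a + n * t) = ?x [^]\<^bsub>G Mod N\<^esub> a"
        using x by (simp only: Q.nat_pow_mult[symmetric] Q.nat_pow_closed Q.r_one)
      then show "?x [^]\<^bsub>G Mod N\<^esub> a \<in> (\<lambda>h. N #>\<^bsub>G\<^esub> h) ` S" using h by auto
    qed
    moreover have "inj_on (\<lambda>a. ?x [^]\<^bsub>G Mod N\<^esub> a) (totatives n)"
      \<comment> \<open>Totatives lie between 1 and \<open>n\<close>, and powers of an element of
        order \<open>n\<close> are distinct on that range, including for
        \<open>n = 1\<close>.\<close>
      by (rule inj_on_subset[OF Q.ord_inj'[OF x]]) (auto simp: in_totatives_iff n_def)
    ultimately have "card (totatives n) \<le> card S"
      using surj_card_le[OF assms(3)] card_image by metis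
    then have "n dvd L" unfolding L_def using totient_le_imp_dvd_fact[OF n]
      by (simp add: totient_def)
    then have "?x [^]\<^bsub>G Mod N\<^esub> L = \<one>\<^bsub>G Mod N\<^esub>" using Q.pow_eq_id[OF x] by (simp add: n_def)
    then have "N #>\<^bsub>G\<^esub> (g [^]\<^bsub>G\<^esub> L) = N" unfolding pow by (simp add: FactGroup_def)
    then have "g [^]\<^bsub>G\<^esub> L \<in> N"
      using rcos_self[OF nat_pow_closed[OF g] normal_imp_subgroup[OF N(1)]] by blast
    then show False using N1(3) by (simp add: N_def)
  qed
  then have "ord g dvd L" using pow_eq_id[OF g] by simp
  moreover have "L > 0" by (simp add: L_def)
  ultimately show ?thesis using dvd_pos_nat by blast
qed

section \<open>From rationality in finite quotients to conciseness\<close>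

lemma coset_rational_Un: "\<lbrakk>coset_rational G S; coset_rational G T\<rbrakk> \<Longrightarrow> coset_rational G (S \<union> T)"
  unfolding coset_rational_def by (metis Un_iff)

text \<open>Coset rationality makes the elements of a finite defined set torsion, and such a set is
  closed under conjugation, so Dietzmann's lemma applies.\<close>

lemma concise_if_coset_rational:
  assumes "\<And>G :: 'a monoid. residually_finite G \<Longrightarrow> coset_rational G (definable_set G \<phi>)"
  shows "concise \<phi> {G :: 'a monoid. residually_finite G}"
  unfolding concise_def verbal_subgroup_def
proof (intro ballI impI)
  fix G :: "'a monoid" assume "G \<in> {G. residually_finite G}" and fin: "finite (definable_set G \<phi>)"
  then have rf: "residually_finite G" by simp
  then interpret group G by (simp add: residually_finite_def)
  show "finite (generate G (definable_set G \<phi>))"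
    using definable_set_subset definable_set_conj_closed fin
      coset_rational_torsion[OF rf definable_set_subset fin assms[OF rf]]
    by (rule finite_generate_conjugation_closed_torsion)
qed

theorem theorem1p4:
  fixes \<phi> \<psi> :: formula
  assumes "disjunction_of weakly_rational_word_formula \<phi>"
    and "positive_combination_of ena_outer_product_formula \<psi>"
  shows "concise (Disj \<phi> \<psi>) {G :: 'a monoid. residually_finite G} \<and>
         concise (Conj \<phi> \<psi>) {G :: 'a monoid. residually_finite G}"
proof (intro conjI concise_if_coset_rational)
  fix G :: "'a monoid" assume rf: "residually_finite G"
  then interpret group G by (simp add: residually_finite_def)
  note \<phi> = weakly_rational_coset[OF assms(1)]
  \<comment> \<open>Any \<open>h\<close> in \<open>S\<close> that matches \<open>g [^] m\<close>
    modulo a small \<open>N\<close> automatically satisfies \<open>\<psi>\<close>. The set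
    \<open>S\<close> is left open in order to cover both \<open>\<psi>\<close> alone and the
    conjunction.\<close>
  have \<psi>: "\<exists>N\<^sub>0. N\<^sub>0 \<lhd> G \<and> finite (rcosets\<^bsub>G\<^esub> N\<^sub>0) \<and>
     (\<forall>N. N \<lhd> G \<longrightarrow> finite (rcosets\<^bsub>G\<^esub> N) \<longrightarrow> N \<subseteq> N\<^sub>0 \<longrightarrow> (\<forall>m. coprime m (order (G Mod N)) \<longrightarrow>
       (\<exists>h\<in>S \<inter> definable_set G \<psi>. N #>\<^bsub>G\<^esub> h = N #>\<^bsub>G\<^esub> (g [^]\<^bsub>G\<^esub> m))))"
    if g: "g \<in> definable_set G \<psi>" and S: "S \<subseteq> carrier G"
      and ex: "\<And>N m. \<lbrakk>N \<lhd> G; finite (rcosets\<^bsub>G\<^esub> N); coprime m (order (G Mod N))\<rbrakk>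
        \<Longrightarrow> \<exists>h\<in>S. N #>\<^bsub>G\<^esub> h = N #>\<^bsub>G\<^esub> (g [^]\<^bsub>G\<^esub> m)" for g S
  proof -
    have gG: "g \<in> carrier G" using g definable_set_subset by auto
    obtain N\<^sub>0 where N0: "N\<^sub>0 \<lhd> G" "finite (rcosets\<^bsub>G\<^esub> N\<^sub>0)" and open_N0:
      "\<And>h j. \<lbrakk>h \<in> carrier G; N\<^sub>0 #>\<^bsub>G\<^esub> (h [^]\<^bsub>G\<^esub> (j::nat)) = N\<^sub>0 #>\<^bsub>G\<^esub> g\<rbrakk> \<Longrightarrow> h \<in> definable_set G \<psi>"
      using positive_combination_coset[OF assms(2) rf g] by blast
    show ?thesis
    proof (intro exI[of _ N\<^sub>0] conjI allI impI N0)
      fix N m assume N: "N \<lhd> G" "finite (rcosets\<^bsub>G\<^esub> N)" "N \<subseteq> N\<^sub>0" and m: "coprime m (order (G Mod N))"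
      obtain h where h: "h \<in> S" "N #>\<^bsub>G\<^esub> h = N #>\<^bsub>G\<^esub> (g [^]\<^bsub>G\<^esub> m)" using ex[OF N(1,2) m] by blast
      have hG: "h \<in> carrier G" using h(1) S by auto
      interpret Q: group "G Mod N" by (rule finite_quotient[OF N(1,2)])
      let ?x = "N #>\<^bsub>G\<^esub> g"
      have x: "?x \<in> carrier (G Mod N)" using gG by (auto simp: FactGroup_def RCOSETS_def)
      \<comment> \<open>Since \<open>j\<close> inverts \<open>m\<close> modulo the order of the
        quotient, \<open>h [^] j\<close> agrees with \<open>g\<close> modulo \<open>N\<close>, hence
        modulo \<open>N\<^sub>0\<close>.\<close>
      obtain j where j: "[m * j = 1] (mod order (G Mod N))"
        using cong_solve_coprime_nat[OF m] by auto
      have "N #>\<^bsub>G\<^esub> (h [^]\<^bsub>G\<^esub> j) = ?x [^]\<^bsub>G Mod N\<^esub> (m * j)"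
        using normal.FactGroup_pow[OF N(1) hG, of j] normal.FactGroup_pow[OF N(1) gG, of m] h(2) x
        by (simp add: Q.nat_pow_pow[symmetric])
      also have "\<dots> = ?x [^]\<^bsub>G Mod N\<^esub> (1::nat)"
        using j by (rule Q.nat_pow_cong_order[OF x])
      also have "\<dots> = ?x" by (rule Q.nat_pow_eone[OF x])
      finally have "N\<^sub>0 #>\<^bsub>G\<^esub> (h [^]\<^bsub>G\<^esub> j) = N\<^sub>0 #>\<^bsub>G\<^esub> g"
        by (rule r_coset_eq_mono[OF normal_imp_subgroup[OF N(1)] normal_imp_subgroup[OF N0(1)] N(3)
              nat_pow_closed[OF hG] gG])
      with hG have "h \<in> definable_set G \<psi>" by (rule open_N0)
      with h show "\<exists>h\<in>S \<inter> definable_set G \<psi>. N #>\<^bsub>G\<^esub> h = N #>\<^bsub>G\<^esub> (g [^]\<^bsub>G\<^esub> m)" by blast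
    qed
  qed
  have "coset_rational G (definable_set G \<phi>)"
    unfolding coset_rational_def
  proof
    fix g assume "g \<in> definable_set G \<phi>"
    from \<phi>[OF _ _ this] show "\<exists>N\<^sub>0. N\<^sub>0 \<lhd> G \<and> finite (rcosets\<^bsub>G\<^esub> N\<^sub>0) \<and>
     (\<forall>N. N \<lhd> G \<longrightarrow> finite (rcosets\<^bsub>G\<^esub> N) \<longrightarrow> N \<subseteq> N\<^sub>0 \<longrightarrow> (\<forall>m. coprime m (order (G Mod N)) \<longrightarrow>
       (\<exists>h\<in>definable_set G \<phi>. N #>\<^bsub>G\<^esub> h = N #>\<^bsub>G\<^esub> (g [^]\<^bsub>G\<^esub> m))))"
      \<comment> \<open>For \<open>\<phi>\<close> every finite quotient is deep enough, so the
        threshold is the whole group.\<close>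
      by (intro exI[of _ "carrier G"] conjI normal_self finite_rcosets_self) blast
  qed
  moreover have "coset_rational G (definable_set G \<psi>)"
    unfolding coset_rational_def
  proof
    fix g assume g: "g \<in> definable_set G \<psi>"
    then have pow: "g [^]\<^bsub>G\<^esub> (m::nat) \<in> carrier G" for m using definable_set_subset by auto
    show "\<exists>N\<^sub>0. N\<^sub>0 \<lhd> G \<and> finite (rcosets\<^bsub>G\<^esub> N\<^sub>0) \<and>
     (\<forall>N. N \<lhd> G \<longrightarrow> finite (rcosets\<^bsub>G\<^esub> N) \<longrightarrow> N \<subseteq> N\<^sub>0 \<longrightarrow> (\<forall>m. coprime m (order (G Mod N)) \<longrightarrow>
       (\<exists>h\<in>definable_set G \<psi>. N #>\<^bsub>G\<^esub> h = N #>\<^bsub>G\<^esub> (g [^]\<^bsub>G\<^esub> m))))"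
      \<comment> \<open>With \<open>S = carrier G\<close>, the power \<open>g [^] m\<close> itself
        is the required element of \<open>S\<close>.\<close>
      by (rule \<psi>[OF g order_refl, unfolded Int_absorb1[OF definable_set_subset]])
         (use pow in blast)
  qed
  ultimately show "coset_rational G (definable_set G (Disj \<phi> \<psi>))"
    unfolding definable_set_Disj by (rule coset_rational_Un)
  show "coset_rational G (definable_set G (Conj \<phi> \<psi>))"
    unfolding coset_rational_def definable_set_Conj
  \<comment> \<open>Now \<open>S\<close> is the set defined by \<open>\<phi>\<close>: weak
    rationality supplies \<open>h\<close> there, and closeness to \<open>g [^] m\<close> puts it
    into the set defined by \<open>\<psi>\<close> as well.\<close>
  proof (rule ballI, rule \<psi>)
    fix g N m assume g: "g \<in> definable_set G \<phi> \<inter> definable_set G \<psi>"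
    then show "g \<in> definable_set G \<psi>" by simp
    assume "N \<lhd> G" "finite (rcosets\<^bsub>G\<^esub> N)" "coprime m (order (G Mod N))"
    with g show "\<exists>h\<in>definable_set G \<phi>. N #>\<^bsub>G\<^esub> h = N #>\<^bsub>G\<^esub> (g [^]\<^bsub>G\<^esub> m)" by (intro \<phi>) auto
  qed (rule definable_set_subset)
qed

end
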